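(* Fix $\alpha>1$, $\delta\in(0,1)$, $n_d\in\mathbb{N}$. Let $(P,P')$, with $P$ a distribution on $\{0,\dots,n_d-1\}$ and $P'$ a distribution on $\{1,\dots,n_d-1\}$, be an optimal solution of the convex program $$\text{minimize } \sum_{x} P'(x)^\alpha P'(n_d-x)^{1-\alpha}$$ subject to $P(x)\ge0$, $\sum_x P(x)=\sum_x P'(x)=1$, $0\le P'(x)\le\frac{P(x)}{1-\delta}$, and $P(x)=P(n_d-1-x)$ for all $x$. Then $P$ minimizes $\varepsilon(X) := \max\{D^\delta_\alpha(X\|X_+),\,D^\delta_\alpha(X_+\|X)\}$ over all probability distributions $X$ supported on $\{0,\dots,n_d-1\}$. Equivalently, $P$ (up to translation) gives the best $(\delta,\alpha,\varepsilon)$-RDP guarantee among all additive-noise partition selection mechanisms whose primitive $\pi$ satisfies $\pi(n_d)=1$.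
   Context: Conventions: $0^\alpha 0^{1-\alpha}=0$, $u^\alpha0^{1-\alpha}=\infty$ for $u>0$. For a distribution $X$ on $\mathbb{Z}$, $X_+$ is its shift by one: $X_+(x)=X(x-1)$. For $\alpha>1$, $D_\alpha(P\|Q)=\frac{1}{\alpha-1}\log\sum_x P(x)^\alpha Q(x)^{1-\alpha}$, and $D^\delta_\alpha(P\|Q)=\inf\{D_\alpha(P'\|Q'): P=(1-\delta)P'+\delta P'',\ Q=(1-\delta)Q'+\delta Q''\}$ over probability distributions. An additive-noise partition selection mechanism is given by a distribution $X$ with finite support in $(-\infty,\tau]\cap\mathbb{Z}$; on count $n$ it samples $Z\sim X$, releases $n+Z$, and keeps the partition iff $n+Z>\tau$, so its primitive is $\pi_X(n)=\Pr_{Z\sim X}(n+Z>\tau)$; for count-neighbors differing by one, it is $(\delta,\alpha,\varepsilon)$-RDP exactly when $\varepsilon\ge\max\{D^\delta_\alpha(X\|X_+),D^\delta_\alpha(X_+\|X)\}$. The condition $\pi_X(n_d)=1$ means the support of $X$ lies in $n_d$ consecutive integers, which up to translation is $\{0,\dots,n_d-1\}$. *)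

theory Defs
  imports Complex_Main "HOL-Library.Extended_Real"
begin

definition supp :: "(int \<Rightarrow> real) \<Rightarrow> int set" where
  "supp P = {x. P x \<noteq> 0}"

definition is_dist :: "(int \<Rightarrow> real) \<Rightarrow> bool" where
  "is_dist P \<longleftrightarrow> (\<forall>x. 0 \<le> P x) \<and> finite (supp P) \<and> (\<Sum>x\<in>supp P. P x) = 1"

text \<open>The term u^alpha v^(1-alpha) with the conventions 0^a 0^(1-a) = 0 and
  u^a 0^(1-a) = infinity for u > 0 (arguments assumed nonnegative).\<close>
definition rterm :: "real \<Rightarrow> real \<Rightarrow> real \<Rightarrow> ereal" where
  "rterm \<alpha> u v = (if u = 0 then 0 else if v = 0 then \<infinity>
                   else ereal (u powr \<alpha> * v powr (1 - \<alpha>)))"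

definition renyi :: "real \<Rightarrow> (int \<Rightarrow> real) \<Rightarrow> (int \<Rightarrow> real) \<Rightarrow> ereal" where
  "renyi \<alpha> P Q =
     (let S = (\<Sum>x\<in>supp P \<union> supp Q. rterm \<alpha> (P x) (Q x))
      in if S = \<infinity> then \<infinity> else ereal (ln (real_of_ereal S) / (\<alpha> - 1)))"

definition renyi_approx :: "real \<Rightarrow> real \<Rightarrow> (int \<Rightarrow> real) \<Rightarrow> (int \<Rightarrow> real) \<Rightarrow> ereal" where
  "renyi_approx \<alpha> \<delta> P Q =
     (INF D \<in> {(P1, P2, Q1, Q2). is_dist P1 \<and> is_dist P2 \<and> is_dist Q1 \<and> is_dist Q2 \<and>
                 P = (\<lambda>x. (1 - \<delta>) * P1 x + \<delta> * P2 x) \<and>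
                 Q = (\<lambda>x. (1 - \<delta>) * Q1 x + \<delta> * Q2 x)}.
        renyi \<alpha> (fst D) (fst (snd (snd D))))"

definition shift :: "(int \<Rightarrow> real) \<Rightarrow> (int \<Rightarrow> real)" where
  "shift X = (\<lambda>x. X (x - 1))"

definition rdp_eps :: "real \<Rightarrow> real \<Rightarrow> (int \<Rightarrow> real) \<Rightarrow> ereal" where
  "rdp_eps \<alpha> \<delta> X = max (renyi_approx \<alpha> \<delta> X (shift X)) (renyi_approx \<alpha> \<delta> (shift X) X)"

definition cp_obj :: "real \<Rightarrow> nat \<Rightarrow> (int \<Rightarrow> real) \<Rightarrow> ereal" where
  "cp_obj \<alpha> n P' = (\<Sum>x\<in>{1..int n - 1}. rterm \<alpha> (P' x) (P' (int n - x)))"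

definition cp_feasible :: "real \<Rightarrow> nat \<Rightarrow> (int \<Rightarrow> real) \<Rightarrow> (int \<Rightarrow> real) \<Rightarrow> bool" where
  "cp_feasible \<delta> n P P' \<longleftrightarrow>
     (\<forall>x. x \<notin> {0..int n - 1} \<longrightarrow> P x = 0) \<and>
     (\<forall>x. x \<notin> {1..int n - 1} \<longrightarrow> P' x = 0) \<and>
     (\<forall>x\<in>{0..int n - 1}. 0 \<le> P x) \<and>
     (\<Sum>x\<in>{0..int n - 1}. P x) = 1 \<and>
     (\<Sum>x\<in>{1..int n - 1}. P' x) = 1 \<and>
     (\<forall>x\<in>{1..int n - 1}. 0 \<le> P' x \<and> P' x \<le> P x / (1 - \<delta>)) \<and>
     (\<forall>x\<in>{0..int n - 1}. P x = P (int n - 1 - x))"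

end

theory Submission
  imports Defs "HOL-Analysis.Convex"
begin

text \<open>
  Suppose both approximate divergences of \<open>X\<close> are small. Averaging the decomposition behind one of
  them with the reflection of the decomposition behind the other yields distributions
  \<open>a \<le> c\<close> and \<open>b \<le> d\<close>, where \<open>c = Q / (1 - \<delta>)\<close> for the symmetrised distribution
  \<open>Q x = (X x + X (n - 1 - x)) / 2\<close> and \<open>d x = c (n - x)\<close>. Among all such pairs the divergence is minimised by
  \<open>min c (l * d)\<close> and \<open>min d (l * c)\<close>, where the factor \<open>l \<ge> 1\<close> makes the total mass 1; if already
  \<open>min c d\<close> has mass at least 1, a multiple of it has divergence zero. The minimising pair
  consists of a function \<open>w\<close> and its reflection \<open>w (n - x)\<close>, so \<open>(Q, w)\<close> is feasible for the convex program.
  Conversely, every feasible \<open>(P, P')\<close> decomposes both \<open>P\<close> and its shift, which by symmetry of \<open>P\<close> is a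
  reflection of \<open>P\<close>.
\<close>

section \<open>Linearisation of the Renyi summand\<close>

text \<open>The function \<open>u powr \<alpha> * v powr (1 - \<alpha>)\<close> is convex and homogeneous of degree 1, so it dominates
  its linearisation along any ray \<open>u = r * v\<close>.\<close>

lemma powr_tangent_le:
  fixes \<alpha> r u v :: real
  assumes "1 < \<alpha>" "0 < r" "0 \<le> u" "0 \<le> v" "v = 0 \<longrightarrow> u = 0"
  shows "\<alpha> * r powr (\<alpha> - 1) * u + (1 - \<alpha>) * r powr \<alpha> * v \<le> u powr \<alpha> * v powr (1 - \<alpha>)"
proof (cases "u = 0")
  case True
  have "(1 - \<alpha>) * (r powr \<alpha> * v) \<le> 0"
    using assms by (intro mult_nonpos_nonneg) auto
  then show ?thesis using True by (simp add: mult.assoc)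
next
  case False
  then have u: "u > 0" and v: "v > 0" using assms by auto
  define x where "x = u powr \<alpha> * v powr (1 - \<alpha>)"
  define y where "y = r powr \<alpha> * v"
  \<comment> \<open>Weighted AM-GM; \<open>x\<close> and \<open>y\<close> are chosen so that the
    powers of \<open>v\<close> cancel and the geometric mean is linear in \<open>u\<close>.\<close>
  have "x powr (1/\<alpha>) * y powr (1 - 1/\<alpha>) \<le> (1/\<alpha>) * x + (1 - 1/\<alpha>) * y"
    using assms u v by (intro Youngs_inequality_0) (auto simp: x_def y_def field_simps)
  moreover have "x powr (1/\<alpha>) * y powr (1 - 1/\<alpha>) = u * r powr (\<alpha> - 1)"
  proof -
    have "x powr (1/\<alpha>) = u * v powr ((1 - \<alpha>)/\<alpha>)"
      using assms u v by (simp add: x_def powr_mult powr_powr)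
    moreover have "y powr (1 - 1/\<alpha>) = r powr (\<alpha> - 1) * v powr (-((1 - \<alpha>)/\<alpha>))"
    proof -
      have "\<alpha> * (1 - 1/\<alpha>) = \<alpha> - 1" "1 - 1/\<alpha> = -((1 - \<alpha>)/\<alpha>)"
        using assms by (auto simp: field_simps)
      then show ?thesis using assms v by (metis powr_mult powr_powr y_def)
    qed
    ultimately show ?thesis using v by (simp add: powr_minus)
  qed
  ultimately have "\<alpha> * (u * r powr (\<alpha> - 1)) \<le> \<alpha> * ((1/\<alpha>) * x + (1 - 1/\<alpha>) * y)"
    using assms by simp
  also have "\<dots> = x + (\<alpha> - 1) * y" using assms by (simp add: field_simps)
  finally show ?thesis by (simp add: x_def y_def algebra_simps)
qed

text \<open>The linearisation is exact on its own ray, here \<open>r = u / v\<close>; this evaluates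
  the objective at the optimal pair.\<close>

lemma powr_tangent_eq:
  fixes \<alpha> u v :: real
  assumes "0 < u" "0 < v"
  shows "\<alpha> * (u / v) powr (\<alpha> - 1) * u + (1 - \<alpha>) * (u / v) powr \<alpha> * v = u powr \<alpha> * v powr (1 - \<alpha>)"
proof -
  have "(u / v) powr (\<alpha> - 1) * u = u powr \<alpha> * v powr (1 - \<alpha>)"
    using assms by (simp add: powr_divide powr_diff)
  moreover have "(u / v) powr \<alpha> * v = u powr \<alpha> * v powr (1 - \<alpha>)"
    using assms by (simp add: powr_divide powr_diff)
  ultimately show ?thesis by (simp add: algebra_simps)
qed

section \<open>Optimality of the truncated pair\<close>

lemma sum_reflect_int: "(\<Sum>x\<in>{a..b}. f (a + b - x)) = (\<Sum>x\<in>{a..b}. f (x::int))"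
  by (rule sum.reindex_bij_witness[where i="\<lambda>x. a + b - x" and j="\<lambda>x. a + b - x"]) auto

text \<open>Intermediate value theorem in \<open>l\<close>: the mass is at most 1 at
  \<open>l = 1\<close>, and for large \<open>l\<close> the minimum dominates \<open>a\<close>, which
  has mass 1 and vanishes wherever \<open>d\<close> does.\<close>

lemma exists_scaled_min_sum_eq_1:
  fixes a c d :: "'a \<Rightarrow> real"
  assumes "finite I" "\<And>x. x \<in> I \<Longrightarrow> 0 \<le> c x" "\<And>x. x \<in> I \<Longrightarrow> 0 \<le> d x"
    and "\<And>x. x \<in> I \<Longrightarrow> a x \<le> c x" "\<And>x. x \<in> I \<Longrightarrow> d x = 0 \<Longrightarrow> a x = 0"
    and "sum a I = 1" "(\<Sum>x\<in>I. min (c x) (d x)) \<le> 1"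
  shows "\<exists>l\<ge>1. (\<Sum>x\<in>I. min (c x) (l * d x)) = 1"
proof -
  define K where "K = 1 + (\<Sum>x\<in>I. c x / d x)"
  have K: "1 \<le> K" unfolding K_def using assms by (auto intro!: sum_nonneg)
  have "a x \<le> min (c x) (K * d x)" if "x \<in> I" for x
  proof (cases "d x = 0")
    case True then show ?thesis using assms that by auto
  next
    case False
    then have d: "d x > 0" using assms(3)[OF that] by simp
    have "c x / d x \<le> (\<Sum>x\<in>I. c x / d x)"
      using assms that by (intro member_le_sum) auto
    then have "c x / d x \<le> K" by (simp add: K_def)
    then have "c x \<le> K * d x" using d by (simp add: field_simps)
    then show ?thesis using assms(4)[OF that] by simp
  qed
  then have "sum a I \<le> (\<Sum>x\<in>I. min (c x) (K * d x))" by (rule sum_mono)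
  then have "1 \<le> (\<Sum>x\<in>I. min (c x) (K * d x))" using assms by simp
  moreover have "continuous_on {1..K} (\<lambda>l. \<Sum>x\<in>I. min (c x) (l * d x))"
    by (intro continuous_intros)
  ultimately show ?thesis
    using IVT'[of "\<lambda>l. \<Sum>x\<in>I. min (c x) (l * d x)" 1 1 K] K assms(7) by auto
qed

text \<open>A Lagrange multiplier argument. The lower bound is linear in \<open>(a, b)\<close>, so
  for an average of two pairs it splits, and each half is controlled by
  \<open>powr_tangent_le\<close>. The zero set of \<open>w\<close> is symmetric under reflection,
  which keeps the objective finite.\<close>

lemma truncated_pair_optimal:
  fixes \<alpha> :: real and n :: nat and a b c :: "int \<Rightarrow> real"
  assumes \<alpha>: "1 < \<alpha>" and c: "\<And>x. 0 \<le> c x"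
    and a: "\<And>x. 0 \<le> a x" "\<And>x. a x \<le> c x" and b: "\<And>x. 0 \<le> b x" "\<And>x. b x \<le> c (int n - x)"
    and ab: "\<And>x. b x = 0 \<Longrightarrow> a x = 0"
    and sa: "sum a {0..int n} = 1" and sb: "sum b {0..int n} = 1"
  obtains w r where "\<And>x. 0 \<le> w x" "\<And>x. w x \<le> c x" "\<And>x. w x = 0 \<longleftrightarrow> c x = 0 \<or> c (int n - x) = 0"
    "sum w {0..int n} = 1" "\<And>x. 0 < r x"
    "(\<Sum>x\<in>{0..int n}. w x powr \<alpha> * w (int n - x) powr (1 - \<alpha>))
      \<le> (\<Sum>x\<in>{0..int n}. \<alpha> * r x powr (\<alpha> - 1) * a x + (1 - \<alpha>) * r x powr \<alpha> * b x)"
proof (cases "(\<Sum>x\<in>{0..int n}. min (c x) (c (int n - x))) \<le> 1")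
  case False
  define M where "M = (\<Sum>x\<in>{0..int n}. min (c x) (c (int n - x)))"
  have M: "M > 1" using False by (simp add: M_def)
  \<comment> \<open>This \<open>w\<close> is its own reflection, so the left-hand sum is just its
    mass 1; with constant ratio 1 the right-hand side is \<alpha> + (1 - \<alpha>) = 1.\<close>
  define w where "w x = min (c x) (c (int n - x)) / M" for x
  have w0: "0 \<le> w x" for x using c M by (simp add: w_def)
  have wsym: "w (int n - x) = w x" for x by (simp add: w_def min.commute)
  have sw: "sum w {0..int n} = 1"
    using M by (simp add: w_def[abs_def] M_def flip: sum_divide_distrib)
  have "(\<Sum>x\<in>{0..int n}. w x powr \<alpha> * w (int n - x) powr (1 - \<alpha>)) = sum w {0..int n}"
    using w0 by (intro sum.cong) (auto simp: wsym simp flip: powr_add)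
  moreover have "(\<Sum>x\<in>{0..int n}. \<alpha> * 1 powr (\<alpha> - 1) * a x + (1 - \<alpha>) * 1 powr \<alpha> * b x) = 1"
    using sa sb by (simp add: sum.distrib flip: sum_distrib_left)
  moreover have "w x \<le> c x" for x
  proof -
    have "min (c x) (c (int n - x)) / M \<le> c x / 1"
      using M c by (intro frac_le) auto
    then show ?thesis by (simp add: w_def)
  qed
  moreover have "w x = 0 \<longleftrightarrow> c x = 0 \<or> c (int n - x) = 0" for x
    using M c[of x] c[of "int n - x"] by (auto simp: w_def min_def)
  ultimately show ?thesis using that[of w "\<lambda>_. 1"] w0 sw by simp
next
  case True
  define d where "d x = c (int n - x)" for x
  have d: "0 \<le> d x" for x using c by (simp add: d_def)
  have bd: "b x \<le> d x" for x using b by (simp add: d_def)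
  obtain l where l: "l \<ge> 1" and sl: "(\<Sum>x\<in>{0..int n}. min (c x) (l * d x)) = 1"
  proof -
    have "a x = 0" if "d x = 0" for x
      using that bd[of x] b(1)[of x] ab by force
    then show ?thesis
      using exists_scaled_min_sum_eq_1[of "{0..int n}" c d a] True c d a sa that
      by (auto simp: d_def)
  qed
  define w where "w x = min (c x) (l * d x)" for x
  define v where "v x = w (int n - x)" for x
  have v_eq: "v x = min (d x) (l * c x)" for x by (simp add: v_def w_def d_def)
  have w0: "0 \<le> w x" and v0: "0 \<le> v x" for x using c d l by (auto simp: w_def v_eq)
  have wz: "w x = 0 \<longleftrightarrow> c x = 0 \<or> d x = 0" for x
    using c[of x] d[of x] l by (auto simp: w_def min_def)
  have vz: "v x = 0 \<longleftrightarrow> c x = 0 \<or> d x = 0" for x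
    using c[of x] d[of x] l by (auto simp: v_eq min_def)
  have le_l: "y \<le> l * y" if "0 \<le> y" for y using mult_right_mono[OF l that] by simp
  \<comment> \<open>Together with its mirror image \<open>vw\<close>, this confines the ratio of
    \<open>w\<close> to \<open>v\<close> to the interval from \<open>1 / l\<close> to
    \<open>l\<close>.\<close>
  have wv: "w x \<le> l * v x" for x
  proof -
    have "c x \<le> l * (l * c x)" using le_l[OF c[of x]] le_l[of "l * c x"] c[of x] by linarith
    then have "w x \<le> l * (l * c x)" "w x \<le> l * d x" by (auto simp: w_def)
    then show ?thesis by (auto simp: v_eq min_def)
  qed
  have vw: "v x \<le> l * w x" for x
    using wv[of "int n - x"] by (simp add: v_def)
  \<comment> \<open>Where \<open>w\<close> and hence \<open>v\<close> vanish, \<open>a\<close>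
    vanishes too, but \<open>b\<close> may be positive if \<open>c x = 0\<close>; the default
    \<open>1 / l\<close> makes \<open>B\<close> hold there.\<close>
  define r where "r x = (if w x = 0 then 1 / l else w x / v x)" for x
  have wpos: "0 < w x" "0 < v x" if "w x \<noteq> 0" for x
    using that wz vz w0[of x] v0[of x] by (auto simp: less_le)
  have r_lo: "1 / l \<le> r x" for x
    using wpos[of x] vw[of x] l by (auto simp: r_def field_simps)
  have r_hi: "r x \<le> l" for x
  proof (cases "w x = 0")
    case True
    have "1 * 1 \<le> l * l" using l by (intro mult_mono) auto
    then show ?thesis using True l by (simp add: r_def field_simps)
  next
    case False
    then show ?thesis using wpos[of x] wv[of x] by (simp add: r_def field_simps)
  qed
  have rp: "0 < r x" for x using r_lo[of x] l by (meson less_le_trans zero_less_divide_1_iff zero_less_one)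
  \<comment> \<open>\<open>ga\<close> and \<open>gb\<close> are the partial derivatives of the
    summand in \<open>u\<close> and \<open>v\<close> at ratio \<open>s\<close>; \<open>ga l\<close>
    and \<open>gb (1 / l)\<close> serve as multipliers for the two mass constraints.\<close>
  define ga where "ga s = \<alpha> * s powr (\<alpha> - 1)" for s
  define gb where "gb s = (1 - \<alpha>) * s powr \<alpha>" for s
  have ga_mono: "ga s \<le> ga t" if "0 < s" "s \<le> t" for s t
    using that \<alpha> by (auto simp: ga_def intro!: mult_left_mono powr_mono2)
  have gb_anti: "gb t \<le> gb s" if "0 < s" "s \<le> t" for s t
    using that \<alpha> by (auto simp: gb_def intro!: mult_left_mono_neg powr_mono2)
  \<comment> \<open>The slope \<open>ga\<close> is largest at the ratio \<open>l\<close>, and \<open>w = c\<close> leaves no room for \<open>a\<close> to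
    exceed \<open>w\<close> wherever the ratio is smaller; dually for \<open>gb\<close> and \<open>1 / l\<close>.\<close>
  have A: "0 \<le> (ga (r x) - ga l) * (a x - w x)" for x
  proof (cases "a x \<le> w x")
    case True
    then show ?thesis using ga_mono[OF rp r_hi] by (simp add: mult_nonpos_nonpos)
  next
    case False
    then have ax: "a x > 0" using w0[of x] by simp
    then have "d x > 0" using ab[of x] bd[of x] b(1)[of x] by force
    moreover have "c x > l * d x" using False a(2)[of x] by (auto simp: w_def min_def split: if_splits)
    moreover from this have "d x \<le> l * c x" using le_l[OF c[of x]] le_l[OF d[of x]] by linarith
    ultimately have "w x = l * d x" "v x = d x" "w x \<noteq> 0" using l by (auto simp: w_def v_eq)
    then show ?thesis using \<open>d x > 0\<close> by (simp add: r_def)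
  qed
  have B: "0 \<le> (gb (r x) - gb (1 / l)) * (b x - v x)" for x
  proof (cases "b x \<le> v x")
    case True
    then show ?thesis using gb_anti[OF _ r_lo] l by (simp add: mult_nonpos_nonpos)
  next
    case False
    then have "d x > l * c x" using bd[of x] by (auto simp: v_eq min_def split: if_splits)
    moreover from this have "c x \<le> l * d x" using le_l[OF c[of x]] le_l[OF d[of x]] by linarith
    ultimately have "w x = c x" "v x = l * c x" using l by (auto simp: w_def v_eq)
    then have "r x = 1 / l" using l by (simp add: r_def)
    then show ?thesis by simp
  qed
  have sw: "sum w {0..int n} = 1" using sl by (simp add: w_def[abs_def])
  have sv: "sum v {0..int n} = 1"
    using sum_reflect_int[of w 0 "int n"] sw by (simp add: v_def[abs_def])
  have E: "w x powr \<alpha> * v x powr (1 - \<alpha>) = ga (r x) * w x + gb (r x) * v x" for x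
  proof (cases "w x = 0")
    case True
    then have "v x = 0" using wz vz by metis
    then show ?thesis using True by simp
  next
    case False
    then show ?thesis using powr_tangent_eq[OF wpos(1) wpos(2), of x x \<alpha>] by (simp add: r_def ga_def gb_def)
  qed
  \<comment> \<open>The multiplier terms drop out on summation, because \<open>a\<close>,
    \<open>b\<close>, \<open>w\<close> and \<open>v\<close> all have mass 1.\<close>
  have "0 \<le> (\<Sum>x\<in>{0..int n}. (ga (r x) - ga l) * (a x - w x) + (gb (r x) - gb (1 / l)) * (b x - v x))"
    using A B by (intro sum_nonneg add_nonneg_nonneg) auto
  also have "\<dots> = (\<Sum>x\<in>{0..int n}. ga (r x) * a x + gb (r x) * b x)
      - (\<Sum>x\<in>{0..int n}. ga (r x) * w x + gb (r x) * v x)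
      - ga l * (sum a {0..int n} - sum w {0..int n}) - gb (1 / l) * (sum b {0..int n} - sum v {0..int n})"
    by (simp add: algebra_simps sum.distrib sum_subtractf sum_distrib_left)
  finally have "(\<Sum>x\<in>{0..int n}. w x powr \<alpha> * v x powr (1 - \<alpha>))
      \<le> (\<Sum>x\<in>{0..int n}. ga (r x) * a x + gb (r x) * b x)"
    by (simp add: E sa sb sw sv)
  then show ?thesis
    using that[of w r] w0 wz sw rp by (simp add: v_def ga_def gb_def d_def w_def)
qed

section \<open>Extended-real sums and approximate divergences\<close>

lemma rterm_nonneg: "0 \<le> rterm \<alpha> u v"
  by (simp add: rterm_def)

lemma sum_rterm_pos:
  assumes "finite I" "x \<in> I" "0 < u x" "\<And>x. 0 \<le> v x"
  shows "0 < (\<Sum>x\<in>I. rterm \<alpha> (u x) (v x))"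
proof -
  have "0 < rterm \<alpha> (u x) (v x)" using assms(3) assms(4)[of x] by (auto simp: rterm_def)
  also have "\<dots> \<le> (\<Sum>x\<in>I. rterm \<alpha> (u x) (v x))"
    using assms sum_mono2[of I "{x}" "\<lambda>x. rterm \<alpha> (u x) (v x)"] rterm_nonneg by simp
  finally show ?thesis .
qed

text \<open>A finite sum has no infinite term; on the remaining zeros of \<open>u\<close> the real
  product is 0, as \<open>rterm\<close> prescribes.\<close>

lemma sum_rterm_finite:
  assumes "finite I" "(\<Sum>x\<in>I. rterm \<alpha> (u x) (v x)) \<noteq> \<infinity>"
  shows "(\<Sum>x\<in>I. rterm \<alpha> (u x) (v x)) = ereal (\<Sum>x\<in>I. u x powr \<alpha> * v x powr (1 - \<alpha>))"
    and "\<And>x. x \<in> I \<Longrightarrow> v x = 0 \<Longrightarrow> u x = 0"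
proof -
  show *: "u x = 0" if "x \<in> I" "v x = 0" for x
  proof (rule ccontr)
    assume "u x \<noteq> 0"
    then have "rterm \<alpha> (u x) (v x) = \<infinity>" using that by (simp add: rterm_def)
    then show False using assms that by (auto simp: sum_Pinfty)
  qed
  show "(\<Sum>x\<in>I. rterm \<alpha> (u x) (v x)) = ereal (\<Sum>x\<in>I. u x powr \<alpha> * v x powr (1 - \<alpha>))"
    unfolding sum_ereal[symmetric] using * by (intro sum.cong) (auto simp: rterm_def)
qed

text \<open>The outer function of \<open>renyi\<close>, split off so that comparing divergences
  reduces to comparing sums over a common finite index set.\<close>

definition renyi_of_sum :: "real \<Rightarrow> ereal \<Rightarrow> ereal" where
  "renyi_of_sum \<alpha> S = (if S = \<infinity> then \<infinity> else ereal (ln (real_of_ereal S) / (\<alpha> - 1)))"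

lemma renyi_of_sum_mono:
  assumes "1 < \<alpha>" "0 < S" "S \<le> T"
  shows "renyi_of_sum \<alpha> S \<le> renyi_of_sum \<alpha> T"
  using assms by (cases S; cases T) (auto simp: renyi_of_sum_def divide_right_mono)

lemma renyi_eq_renyi_of_sum:
  assumes "finite I" "supp u \<union> supp v \<subseteq> I"
  shows "renyi \<alpha> u v = renyi_of_sum \<alpha> (\<Sum>x\<in>I. rterm \<alpha> (u x) (v x))"
proof -
  have "(\<Sum>x\<in>supp u \<union> supp v. rterm \<alpha> (u x) (v x)) = (\<Sum>x\<in>I. rterm \<alpha> (u x) (v x))"
    using assms by (intro sum.mono_neutral_left) (auto simp: supp_def rterm_def)
  then show ?thesis by (simp add: renyi_def renyi_of_sum_def Let_def)
qed

lemma is_dist_sum: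
  assumes "is_dist u" "finite I" "supp u \<subseteq> I"
  shows "sum u I = 1"
proof -
  have "sum u (supp u) = sum u I"
    using assms by (intro sum.mono_neutral_left) (auto simp: supp_def)
  then show ?thesis using assms by (simp add: is_dist_def)
qed

lemma is_distI:
  assumes "\<And>x. 0 \<le> u x" "finite I" "supp u \<subseteq> I" "sum u I = 1"
  shows "is_dist u"
proof -
  have "sum u (supp u) = sum u I"
    using assms by (intro sum.mono_neutral_left) (auto simp: supp_def)
  then show ?thesis using assms finite_subset by (auto simp: is_dist_def)
qed

text \<open>Domination suffices for a decomposition: the remainder
  \<open>(p - (1 - \<delta>) * u) / \<delta>\<close> is nonnegative with mass 1, and likewise for
  \<open>q\<close>.\<close>

lemma renyi_approx_le:
  assumes \<delta>: "0 < \<delta>" "\<delta> < 1" and I: "finite I"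
    and p: "is_dist p" "supp p \<subseteq> I" and q: "is_dist q" "supp q \<subseteq> I"
    and u: "is_dist u" "\<And>x. (1 - \<delta>) * u x \<le> p x" and v: "is_dist v" "\<And>x. (1 - \<delta>) * v x \<le> q x"
  shows "renyi_approx \<alpha> \<delta> p q \<le> renyi_of_sum \<alpha> (\<Sum>x\<in>I. rterm \<alpha> (u x) (v x))"
proof -
  have rest: "is_dist (\<lambda>x. (s x - (1 - \<delta>) * t x) / \<delta>)" and supp_t: "supp t \<subseteq> I"
    if "is_dist s" "supp s \<subseteq> I" "is_dist t" "\<And>x. (1 - \<delta>) * t x \<le> s x" for s t
  proof -
    have zero: "t x = 0" if "s x = 0" for x
    proof -
      have "(1 - \<delta>) * t x \<le> 0" "0 \<le> t x"
        using that \<open>\<And>x. (1 - \<delta>) * t x \<le> s x\<close>[of x] \<open>is_dist t\<close> by (auto simp: is_dist_def)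
      then show ?thesis using \<delta> by (simp add: mult_le_0_iff)
    qed
    then show st: "supp t \<subseteq> I" using that(2) by (auto simp: supp_def)
    have "sum s I = 1" "sum t I = 1" using is_dist_sum that I st by auto
    then have "(\<Sum>x\<in>I. (s x - (1 - \<delta>) * t x) / \<delta>) = 1"
      using \<delta> by (simp add: sum_subtractf flip: sum_divide_distrib sum_distrib_left)
    then show "is_dist (\<lambda>x. (s x - (1 - \<delta>) * t x) / \<delta>)"
      using that \<delta> I zero by (intro is_distI[of _ I]) (auto simp: supp_def)
  qed
  have "renyi_approx \<alpha> \<delta> p q \<le> renyi \<alpha> u v"
    unfolding renyi_approx_def
    using u v rest[OF p u] rest[OF q v] \<delta>
    by (intro INF_lower2[of "(u, \<lambda>x. (p x - (1 - \<delta>) * u x) / \<delta>, v, \<lambda>x. (q x - (1 - \<delta>) * v x) / \<delta>)"])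
       auto
  also have "\<dots> = renyi_of_sum \<alpha> (\<Sum>x\<in>I. rterm \<alpha> (u x) (v x))"
    using supp_t[OF p u] supp_t[OF q v] I by (intro renyi_eq_renyi_of_sum) auto
  finally show ?thesis .
qed

text \<open>An infimum strictly below a bound has a witness below it, attained or not. Dropping the
  remainders leaves domination, and finiteness of the sum forces \<open>u\<close> to vanish where
  \<open>v\<close> does.\<close>

lemma renyi_approx_lessE:
  assumes \<delta>: "0 < \<delta>" "\<delta> < 1" and "1 < \<alpha>" "0 < L" and I: "finite I" "supp p \<union> supp q \<subseteq> I"
    and less: "renyi_approx \<alpha> \<delta> p q < renyi_of_sum \<alpha> L"
  obtains u v where "\<And>x. 0 \<le> u x" "\<And>x. 0 \<le> v x" "\<And>x. (1 - \<delta>) * u x \<le> p x" "\<And>x. (1 - \<delta>) * v x \<le> q x"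
    "sum u I = 1" "sum v I = 1" "\<And>x. v x = 0 \<Longrightarrow> u x = 0"
    "ereal (\<Sum>x\<in>I. u x powr \<alpha> * v x powr (1 - \<alpha>)) < L"
proof -
  obtain u u' v v' where D: "is_dist u" "is_dist u'" "is_dist v" "is_dist v'"
     and p: "p = (\<lambda>x. (1 - \<delta>) * u x + \<delta> * u' x)" and q: "q = (\<lambda>x. (1 - \<delta>) * v x + \<delta> * v' x)"
     and uv: "renyi \<alpha> u v < renyi_of_sum \<alpha> L"
    using less unfolding renyi_approx_def INF_less_iff by auto
  have n0: "0 \<le> u x" "0 \<le> u' x" "0 \<le> v x" "0 \<le> v' x" for x using D by (auto simp: is_dist_def)
  have "u x = 0" if "p x = 0" for x
    using that n0[of x] \<delta> by (auto simp: p add_nonneg_eq_0_iff)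
  moreover have "v x = 0" if "q x = 0" for x
    using that n0[of x] \<delta> by (auto simp: q add_nonneg_eq_0_iff)
  ultimately have supps: "supp u \<subseteq> I" "supp v \<subseteq> I" using I(2) by (auto simp: supp_def)
  define S where "S = (\<Sum>x\<in>I. rterm \<alpha> (u x) (v x))"
  have "renyi_of_sum \<alpha> S < renyi_of_sum \<alpha> L"
    using uv renyi_eq_renyi_of_sum[of I u v \<alpha>] supps I(1) by (simp add: S_def)
  \<comment> \<open>Contrapositive of monotonicity, which asks for positivity of \<open>L\<close>
    only.\<close>
  then have SL: "S < L" using renyi_of_sum_mono[of \<alpha> L S] assms by force
  then have fin: "S \<noteq> \<infinity>" by auto
  note F = sum_rterm_finite[OF I(1) fin[unfolded S_def]]
  show ?thesis
  proof (rule that[of u v])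
    show "u x = 0" if "v x = 0" for x
      using F(2)[of x] that supps by (cases "x \<in> I") (auto simp: supp_def)
    show "ereal (\<Sum>x\<in>I. u x powr \<alpha> * v x powr (1 - \<alpha>)) < L"
      using SL F(1) by (simp add: S_def)
  qed (use n0 \<delta> is_dist_sum D I supps in \<open>auto simp: p q\<close>)
qed

section \<open>From feasible points to divergence bounds\<close>

text \<open>Up to the factor \<open>1 - \<delta>\<close>, \<open>P'\<close> is dominated by
  \<open>P\<close> and its reflection \<open>v\<close> by the shift of \<open>P\<close>. Reflecting
  the index swaps the two, so one sum bounds both directions.\<close>

lemma rdp_eps_le_cp_obj:
  assumes \<delta>: "0 < \<delta>" "\<delta> < 1" and feas: "cp_feasible \<delta> n P P'"
  shows "rdp_eps \<alpha> \<delta> P \<le> renyi_of_sum \<alpha> (cp_obj \<alpha> n P')"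
proof -
  \<comment> \<open>This interval covers the supports of \<open>P\<close> and its shift and is
    invariant under the reflection \<open>n - x\<close>.\<close>
  let ?I = "{0..int n}"
  define v where "v x = P' (int n - x)" for x
  have F: "\<And>x. x \<notin> {0..int n - 1} \<Longrightarrow> P x = 0" "\<And>x. x \<notin> {1..int n - 1} \<Longrightarrow> P' x = 0"
    "\<And>x. x \<in> {0..int n - 1} \<Longrightarrow> 0 \<le> P x" "sum P {0..int n - 1} = 1" "sum P' {1..int n - 1} = 1"
    "\<And>x. x \<in> {1..int n - 1} \<Longrightarrow> 0 \<le> P' x"
    "\<And>x. x \<in> {1..int n - 1} \<Longrightarrow> P' x \<le> P x / (1 - \<delta>)"
    "\<And>x. x \<in> {0..int n - 1} \<Longrightarrow> P x = P (int n - 1 - x)"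
    using feas unfolding cp_feasible_def by blast+
  note Pout = F(1) and P'out = F(2)
  have P0: "0 \<le> P x" for x using F(1,3)[of x] by force
  have P'0: "0 \<le> P' x" for x using F(2,6)[of x] by force
  have le: "(1 - \<delta>) * P' x \<le> P x" for x
  proof (cases "x \<in> {1..int n - 1}")
    case True
    then have "P' x \<le> P x / (1 - \<delta>)" by (rule F(7))
    then show ?thesis using \<delta> by (simp add: field_simps)
  qed (use P'out P0 in auto)
  have refl: "P (int n - 1 - x) = P x" for x
  proof (cases "x \<in> {0..int n - 1}")
    case True
    then show ?thesis using F(8) by metis
  next
    case False
    then show ?thesis using Pout[of x] Pout[of "int n - 1 - x"] by auto
  qed
  \<comment> \<open>Moving by one turns the symmetry about (n - 1) / 2 into a reflection about n /
    2.\<close>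
  have shift: "shift P x = P (int n - x)" for x
    using refl[of "x - 1"] by (simp add: shift_def)
  have sP: "sum P ?I = 1"
  proof -
    have "sum P {0..int n - 1} = sum P ?I" by (rule sum.mono_neutral_left) (auto simp: Pout)
    then show ?thesis using F(4) by simp
  qed
  have sP': "sum P' ?I = 1"
  proof -
    have "sum P' {1..int n - 1} = sum P' ?I" by (rule sum.mono_neutral_left) (auto simp: P'out)
    then show ?thesis using F(5) by simp
  qed
  have suppI: "supp f \<subseteq> ?I" if "\<And>x. x \<notin> ?I \<Longrightarrow> f x = 0" for f :: "int \<Rightarrow> real"
    using that unfolding supp_def by blast
  have supps: "supp P \<subseteq> ?I" "supp (shift P) \<subseteq> ?I" "supp P' \<subseteq> ?I" "supp v \<subseteq> ?I"
    by (auto intro!: suppI Pout P'out simp: shift v_def)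
  have dP: "is_dist P" using P0 sP supps by (intro is_distI[of _ ?I]) auto
  have dsP: "is_dist (shift P)"
    using P0 sP supps sum_reflect_int[of P 0 "int n"]
    by (intro is_distI[of _ ?I]) (auto simp: shift)
  have dP': "is_dist P'" using P'0 sP' supps by (intro is_distI[of _ ?I]) auto
  have dv: "is_dist v"
    using P'0 sP' supps sum_reflect_int[of P' 0 "int n"]
    by (intro is_distI[of _ ?I]) (auto simp: v_def)
  have v_le: "(1 - \<delta>) * v x \<le> shift P x" for x using le by (simp add: shift v_def)
  have obj: "(\<Sum>x\<in>?I. rterm \<alpha> (P' x) (v x)) = cp_obj \<alpha> n P'"
    unfolding cp_obj_def v_def
    by (rule sum.mono_neutral_right) (auto simp: P'out rterm_def)
  have obj': "(\<Sum>x\<in>?I. rterm \<alpha> (v x) (P' x)) = cp_obj \<alpha> n P'"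
    using sum_reflect_int[of "\<lambda>x. rterm \<alpha> (P' x) (v x)" 0 "int n"] obj by (simp add: v_def)
  have "renyi_approx \<alpha> \<delta> P (shift P) \<le> renyi_of_sum \<alpha> (cp_obj \<alpha> n P')"
    unfolding obj[symmetric] using le v_le \<delta> supps dP dsP dP' dv
    by (intro renyi_approx_le) auto
  moreover have "renyi_approx \<alpha> \<delta> (shift P) P \<le> renyi_of_sum \<alpha> (cp_obj \<alpha> n P')"
    unfolding obj'[symmetric] using le v_le \<delta> supps dP dsP dP' dv
    by (intro renyi_approx_le) auto
  ultimately show ?thesis by (simp add: rdp_eps_def)
qed

text \<open>Supplies the positivity that monotonicity of the logarithm needs: some point carries
  mass of \<open>P'\<close>, and its term is positive or infinite.\<close>

lemma cp_obj_pos: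
  assumes "cp_feasible \<delta> n P P'"
  shows "0 < cp_obj \<alpha> n P'"
proof -
  have s: "sum P' {1..int n - 1} = 1" and nn: "\<And>x. 0 \<le> P' x"
    using assms unfolding cp_feasible_def by (blast, metis order_refl)
  obtain x where "x \<in> {1..int n - 1}" "P' x \<noteq> 0"
    using s by (metis sum.neutral zero_neq_one)
  then show ?thesis
    unfolding cp_obj_def using nn by (intro sum_rterm_pos[of _ x P' "\<lambda>x. P' (int n - x)"]) (auto simp: less_le)
qed

section \<open>From divergence bounds to feasible points\<close>

text \<open>The strict threshold \<open>L\<close> avoids any appeal to attained infima:
  decompositions beating \<open>L\<close> in both directions are symmetrised, then truncated to a
  feasible point beating \<open>L\<close>.\<close>

lemma cp_obj_less_of_rdp_eps_less:
  assumes \<alpha>: "1 < \<alpha>" and \<delta>: "0 < \<delta>" "\<delta> < 1" and L: "0 < L"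
    and X: "is_dist X" "supp X \<subseteq> {0..int n - 1}"
    and less: "rdp_eps \<alpha> \<delta> X < renyi_of_sum \<alpha> L"
  shows "\<exists>Q Q'. cp_feasible \<delta> n Q Q' \<and> cp_obj \<alpha> n Q' < L"
proof -
  let ?I = "{0..int n}"
  have Xout: "X x = 0" if "x \<notin> {0..int n - 1}" for x using X that by (auto simp: supp_def)
  have X0: "0 \<le> X x" for x using X by (simp add: is_dist_def)
  have supps: "supp X \<union> supp (shift X) \<subseteq> ?I" "supp (shift X) \<union> supp X \<subseteq> ?I"
    using X(2) by (fastforce simp: supp_def shift_def)+
  have less1: "renyi_approx \<alpha> \<delta> X (shift X) < renyi_of_sum \<alpha> L"
    and less2: "renyi_approx \<alpha> \<delta> (shift X) X < renyi_of_sum \<alpha> L"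
    using less by (auto simp: rdp_eps_def)
  obtain u v where uv: "\<And>x. 0 \<le> u x" "\<And>x. 0 \<le> v x" "\<And>x. (1 - \<delta>) * u x \<le> X x" "\<And>x. (1 - \<delta>) * v x \<le> shift X x"
    "sum u ?I = 1" "sum v ?I = 1" "\<And>x. v x = 0 \<Longrightarrow> u x = 0"
    and uvL: "ereal (\<Sum>x\<in>?I. u x powr \<alpha> * v x powr (1 - \<alpha>)) < L"
    by (rule renyi_approx_lessE[OF \<delta> \<alpha> L _ supps(1) less1]) auto
  obtain s t where st: "\<And>x. 0 \<le> s x" "\<And>x. 0 \<le> t x" "\<And>x. (1 - \<delta>) * s x \<le> shift X x" "\<And>x. (1 - \<delta>) * t x \<le> X x"
    "sum s ?I = 1" "sum t ?I = 1" "\<And>x. t x = 0 \<Longrightarrow> s x = 0"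
    and stL: "ereal (\<Sum>x\<in>?I. s x powr \<alpha> * t x powr (1 - \<alpha>)) < L"
    by (rule renyi_approx_lessE[OF \<delta> \<alpha> L _ supps(2) less2]) auto
  \<comment> \<open>Reflection turns the pair for \<open>(shift X, X)\<close> into one for the
    mirrored \<open>X\<close> and its shift, in the same order as \<open>(u, v)\<close>, so the two
    can be averaged.\<close>
  define s' where "s' x = s (int n - x)" for x
  define t' where "t' x = t (int n - x)" for x
  define Q where "Q x = (X x + X (int n - 1 - x)) / 2" for x
  define a where "a x = (u x + s' x) / 2" for x
  define b where "b x = (v x + t' x) / 2" for x
  have s'X: "(1 - \<delta>) * s' x \<le> X (int n - 1 - x)" for x
    using st(3)[of "int n - x"] by (simp add: s'_def shift_def algebra_simps)
  have t'X: "(1 - \<delta>) * t' x \<le> X (int n - x)" for x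
    using st(4)[of "int n - x"] by (simp add: t'_def)
  have Q0: "0 \<le> Q x" for x using X0 by (simp add: Q_def)
  have aQ: "a x \<le> Q x / (1 - \<delta>)" for x
    using s'X[of x] uv(3)[of x] \<delta> by (simp add: a_def Q_def field_simps)
  have bQ: "b x \<le> Q (int n - x) / (1 - \<delta>)" for x
    using t'X[of x] uv(4)[of x] \<delta> by (simp add: b_def Q_def shift_def field_simps)
  have ab0: "0 \<le> a x" "0 \<le> b x" for x using uv st by (auto simp: a_def b_def s'_def t'_def)
  have ab: "a x = 0" if "b x = 0" for x
  proof -
    have "v x = 0" "t' x = 0" using that uv(2)[of x] st(2)[of "int n - x"] by (auto simp: b_def t'_def)
    then show ?thesis using uv(7) st(7) by (simp add: a_def s'_def t'_def)
  qed
  have ss: "sum s' ?I = 1" "sum t' ?I = 1"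
    using sum_reflect_int[of s 0 "int n"] sum_reflect_int[of t 0 "int n"] st by (auto simp: s'_def t'_def)
  have sa: "sum a ?I = 1" and sb: "sum b ?I = 1"
    using uv ss by (simp_all add: a_def b_def sum.distrib flip: sum_divide_distrib)
  obtain w r where w: "\<And>x. 0 \<le> w x" "\<And>x. w x \<le> Q x / (1 - \<delta>)"
      "\<And>x. w x = 0 \<longleftrightarrow> Q x / (1 - \<delta>) = 0 \<or> Q (int n - x) / (1 - \<delta>) = 0"
      "sum w ?I = 1" "\<And>x. 0 < r x"
    and opt: "(\<Sum>x\<in>?I. w x powr \<alpha> * w (int n - x) powr (1 - \<alpha>))
      \<le> (\<Sum>x\<in>?I. \<alpha> * r x powr (\<alpha> - 1) * a x + (1 - \<alpha>) * r x powr \<alpha> * b x)"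
    by (rule truncated_pair_optimal[of \<alpha> "\<lambda>x. Q x / (1 - \<delta>)" a b n])
       (use \<alpha> \<delta> Q0 ab0 aQ bQ ab sa sb in auto)
  \<comment> \<open>For fixed \<open>r\<close> this is linear in the pair, so its value at
    \<open>(a, b)\<close> is the mean of those at \<open>(u, v)\<close> and \<open>(s', t')\<close>,
    each below \<open>L\<close> by the tangent bound.\<close>
  let ?T = "\<lambda>u v. \<Sum>x\<in>?I. \<alpha> * r x powr (\<alpha> - 1) * u x + (1 - \<alpha>) * r x powr \<alpha> * v x"
  have "?T u v \<le> (\<Sum>x\<in>?I. u x powr \<alpha> * v x powr (1 - \<alpha>))"
    using \<alpha> w(5) uv by (intro sum_mono powr_tangent_le) auto
  then have T1: "ereal (?T u v) < L" using uvL by (meson ereal_less_eq(3) le_less_trans)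
  have "?T s' t' \<le> (\<Sum>x\<in>?I. s' x powr \<alpha> * t' x powr (1 - \<alpha>))"
    using \<alpha> w(5) st by (intro sum_mono powr_tangent_le) (auto simp: s'_def t'_def)
  also have "\<dots> = (\<Sum>x\<in>?I. s x powr \<alpha> * t x powr (1 - \<alpha>))"
    using sum_reflect_int[of "\<lambda>x. s x powr \<alpha> * t x powr (1 - \<alpha>)" 0 "int n"] by (simp add: s'_def t'_def)
  finally have T2: "ereal (?T s' t') < L" using stL by (meson ereal_less_eq(3) le_less_trans)
  have "?T a b = (?T u v + ?T s' t') / 2"
    unfolding sum.distrib[symmetric] sum_divide_distrib
    by (intro sum.cong) (simp_all add: a_def b_def field_simps)
  then have "?T a b \<le> max (?T u v) (?T s' t')" by simp
  then have wL: "ereal (\<Sum>x\<in>?I. w x powr \<alpha> * w (int n - x) powr (1 - \<alpha>)) < L"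
    using opt T1 T2 by (cases L) auto
  have Qout: "Q x = 0" if "x \<notin> {0..int n - 1}" for x
    using that Xout[of x] Xout[of "int n - 1 - x"] by (auto simp: Q_def)
  \<comment> \<open>The endpoint 0 is excluded because its mirror image \<open>n\<close> lies
    outside the support of \<open>Q\<close>.\<close>
  have wout: "w x = 0" if "x \<notin> {1..int n - 1}" for x
    using that w(3) Qout[of x] Qout[of "int n - x"] by force
  have "sum w {1..int n - 1} = sum w ?I"
    by (rule sum.mono_neutral_left) (auto simp: wout)
  moreover have "sum Q {0..int n - 1} = 1"
    using is_dist_sum[OF X(1) _ X(2)] sum_reflect_int[of X 0 "int n - 1"]
    by (simp add: Q_def sum.distrib flip: sum_divide_distrib)
  ultimately have feas: "cp_feasible \<delta> n Q w"
    using w Q0 Qout wout by (auto simp: cp_feasible_def Q_def)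
  have "cp_obj \<alpha> n w = (\<Sum>x\<in>?I. rterm \<alpha> (w x) (w (int n - x)))"
    unfolding cp_obj_def by (rule sum.mono_neutral_left) (auto simp: wout rterm_def)
  \<comment> \<open>\<open>w x\<close> and \<open>w (int n - x)\<close> vanish together, so no term
    is infinite.\<close>
  also have "\<dots> = ereal (\<Sum>x\<in>?I. w x powr \<alpha> * w (int n - x) powr (1 - \<alpha>))"
    unfolding sum_ereal[symmetric] by (intro sum.cong) (auto simp: rterm_def w(3))
  finally show ?thesis using feas wL by metis
qed

theorem mainTheorem13:
  fixes \<alpha> \<delta> :: real and n\<^sub>d :: nat and P P' :: "int \<Rightarrow> real"
  assumes "\<alpha> > 1" and "0 < \<delta>" and "\<delta> < 1"
    and "cp_feasible \<delta> n\<^sub>d P P'"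
    and "\<forall>Q Q'. cp_feasible \<delta> n\<^sub>d Q Q' \<longrightarrow> cp_obj \<alpha> n\<^sub>d P' \<le> cp_obj \<alpha> n\<^sub>d Q'"
  shows "\<forall>X. is_dist X \<and> supp X \<subseteq> {0..int n\<^sub>d - 1} \<longrightarrow> rdp_eps \<alpha> \<delta> P \<le> rdp_eps \<alpha> \<delta> X"
proof (intro allI impI)
  fix X assume X: "is_dist X \<and> supp X \<subseteq> {0..int n\<^sub>d - 1}"
  have "renyi_of_sum \<alpha> (cp_obj \<alpha> n\<^sub>d P') \<le> rdp_eps \<alpha> \<delta> X"
  \<comment> \<open>Otherwise the optimal value, taken as the threshold \<open>L\<close>, would be
    beaten by a feasible point.\<close>
  proof (rule ccontr)
    assume "\<not> ?thesis"
    then obtain Q Q' where "cp_feasible \<delta> n\<^sub>d Q Q'" "cp_obj \<alpha> n\<^sub>d Q' < cp_obj \<alpha> n\<^sub>d P'"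
      using cp_obj_less_of_rdp_eps_less[of \<alpha> \<delta> "cp_obj \<alpha> n\<^sub>d P'" X n\<^sub>d] cp_obj_pos assms X
      by (meson not_le)
    then show False using assms(5) by (meson not_le)
  qed
  then show "rdp_eps \<alpha> \<delta> P \<le> rdp_eps \<alpha> \<delta> X"
    using rdp_eps_le_cp_obj[OF assms(2,3,4)] order_trans by blast
qed

end
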